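(* Let $\mathcal G=(\mathcal V,\mathcal E,\omega)$ be a connected weighted hypergraph, let $\mathbf G$, $\mathbf A_\theta$, $\mathcal S_\phi$, $\mathbf Q_\phi$, $R_\theta$, $\tau_\eta$, $\mathcal R_\eta$ be as defined in the context, and let $\{\mathbf S_R(t)\}_{t\ge0}$ be the global continuous semiflow on $\mathcal X=\mathbb R^{n\times d}$ generated by the HNRD equation $$\frac{d\mathbf X(t)}{dt}=-\mathbf G^\top\mathbf A_\theta(\mathbf X(t))\,\mathbf G\,\mathbf X(t)+\mathcal R_\eta(\mathbf X(t)),\qquad \mathbf X(0)=\mathbf X_0 .$$ Assume that $\mathbf Q_\phi\mathbf X_0\ne0$. Then $$\lim_{t\to\infty}\|\mathbf Q_\phi\mathbf S_R(t)\mathbf X_0\|_F^2=\lim_{t\to\infty}\operatorname{dist}^2\bigl(\mathbf S_R(t)\mathbf X_0,\mathcal S_\phi\bigr)=\tau_\eta>0 .$$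
   Context: Hypergraph. $\mathcal V$ is a finite set of $n\ge 2$ nodes, $\mathcal E$ a finite set of hyperedges, each $e\in\mathcal E$ being a subset of $\mathcal V$ with $|e|\ge 2$, and $\omega_e>0$ is the weight of $e$. The degree of $v$ is $d_v=\#\{e\in\mathcal E: v\in e\}$ (unweighted). The hypergraph is connected if any two nodes can be joined by a finite sequence of nodes in which consecutive nodes lie in a common hyperedge; then $d_v\ge 1$ for all $v$. The incidence set is $\mathcal I=\{(e,v): e\in\mathcal E, v\in e\}$ and $N=|\mathcal I|$. Phase space. $\mathcal X=\mathbb R^{n\times d}$ with Frobenius inner product $\langle\cdot,\cdot\rangle_F$ and norm $\|\cdot\|_F$; row $\mathbf X_v$ of $\mathbf X$ is the representation of node $v$. $\operatorname{dist}(\mathbf X,\mathcal S)=\inf_{\mathbf Y\in\mathcal S}\|\mathbf X-\mathbf Y\|_F$. Gradient matrix. $\mathbf G\in\mathbb R^{N\times n}$ is $\mathbf G=\mathbf\Omega_{\mathcal I}^{1/2}\mathbf P$, where $\mathbf\Omega_{\mathcal I}=\operatorname{diag}(\omega_e)_{(e,v)\in\mathcal I}$ and $(\mathbf P\mathbf f)(e,v)=\frac{\mathbf f(v)}{\sqrt{d_v}}-\frac1{|e|}\sum_{u\in e}\frac{\mathbf f(u)}{\sqrt{d_u}}$; it acts on $\mathbf X\in\mathcal X$ columnwise. Modulation. Fix parameters $\theta$ and $0<\varepsilon<1$. For $\mathbf X\in\mathcal X$ let $\mathbf X_e=\operatorname{Agg}(\{\mathbf X_u:u\in e\})\in\mathbb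 R^d$, with $\operatorname{Agg}$ a permutation-invariant, locally Lipschitz aggregator (such as mean or max pooling), and $r^\theta_{(e,v)}=\sigma(\operatorname{MLP}_\theta(\mathbf X_v\,\|\,\mathbf X_e))\in\mathbb R$, where $\|$ is concatenation, $\sigma$ is LeakyReLU and $\operatorname{MLP}_\theta:\mathbb R^{2d}\to\mathbb R$ is a (locally Lipschitz) multilayer perceptron. Set $$a_\theta(\mathbf X_v,\mathbf X_e)=(1-\varepsilon)\frac{\exp(r^\theta_{(e,v)})}{\sum_{e'\ni v}\exp(r^\theta_{(e',v)})}+\frac{\varepsilon}{d_v},\qquad \mathbf A_\theta(\mathbf X)=\operatorname{diag}(a_\theta(\mathbf X_v,\mathbf X_e))_{(e,v)\in\mathcal I}\in\mathbb R^{N\times N}.$$ Null mode. $\mathbf D_v=\operatorname{diag}(d_v)_{v\in\mathcal V}$, $\phi=\mathbf D_v^{1/2}\mathbf 1\in\mathbb R^n$, $\mathcal S_\phi=\{\phi c: c\in\mathbb R^{1\times d}\}\subset\mathcal X$, $\mathbf\Pi_\phi$ is the orthogonal projector of $\mathcal X$ onto $\mathcal S_\phi$, and $\mathbf Q_\phi=\mathbf I-\mathbf\Pi_\phi$. Reaction term. With $\mathbf Z=\mathbf Q_\phi\mathbf X$, $$R_\theta(\mathbf X)=\frac{\langle\mathbf G\mathbf Z,\mathbf A_\theta(\mathbf X)\mathbf G\mathbf Z\rangle_F}{\|\mathbf Z\|_F^2}\ \text{ if }\mathbf Z\ne0,\qquad R_\theta(\mathbf X)=0\ \text{ if }\mathbf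 Z=0,$$ $$\mathcal R_\eta(\mathbf X)=\bigl[R_\theta(\mathbf X)+\tanh(\tau_\eta-\|\mathbf Q_\phi\mathbf X\|_F^2)\bigr]\mathbf Q_\phi\mathbf X,\qquad \tau_\eta=\operatorname{softplus}(\eta)=\log(1+e^\eta)>0,\ \eta\in\mathbb R\text{ fixed}.$$ Semiflow. For every $\mathbf X_0\in\mathcal X$ the HNRD equation has a unique global $C^1$ solution $\mathbf X(t;\mathbf X_0)$ on $[0,\infty)$, and $\mathbf S_R(t)\mathbf X_0:=\mathbf X(t;\mathbf X_0)$. *)

theory Defs
  imports "HOL-Analysis.Analysis" "HOL-Library.Multiset"
begin

text \<open>
  The node set is the whole finite type \<^typ>\<open>'v\<close>; hyperedges are sets of nodes.
  Finiteness of \<open>E\<close> is automatic. The weight function only matters on \<open>E\<close>.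
\<close>

definition adjacent :: "'v set set \<Rightarrow> 'v \<Rightarrow> 'v \<Rightarrow> bool" where
  "adjacent E u v \<longleftrightarrow> (\<exists>e\<in>E. u \<in> e \<and> v \<in> e)"

definition weighted_hypergraph :: "('v::finite) set set \<Rightarrow> ('v set \<Rightarrow> real) \<Rightarrow> bool" where
  "weighted_hypergraph E \<omega> \<longleftrightarrow>
     CARD('v) \<ge> 2 \<and> (\<forall>e\<in>E. card e \<ge> 2) \<and> (\<forall>e\<in>E. \<omega> e > 0)"

definition connected_hypergraph :: "'v set set \<Rightarrow> bool" where
  "connected_hypergraph E \<longleftrightarrow> (\<forall>u v. (adjacent E)\<^sup>*\<^sup>* u v)"

definition degree :: "'v set set \<Rightarrow> 'v \<Rightarrow> nat" where
  "degree E v = card {e \<in> E. v \<in> e}"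

definition incidences :: "'v set set \<Rightarrow> ('v set \<times> 'v) set" where
  "incidences E = {(e, v). e \<in> E \<and> v \<in> e}"

text \<open>
  Matrices whose rows or columns are indexed by the incidence set are represented as matrices
  over the finite index type \<^typ>\<open>'v set \<times> 'v\<close>, extended by zero outside \<open>incidences E\<close>.
  Zero rows and columns do not affect the products and inner products formed below.
  On \<^typ>\<open>real^'d^'v\<close> the library's inner product and norm are the Frobenius ones.
\<close>

definition diag_on :: "'i set \<Rightarrow> ('i \<Rightarrow> real) \<Rightarrow> real^'i^'i" where
  "diag_on I f = (\<chi> i j. if i = j \<and> i \<in> I then f i else 0)"

definition incidence_difference :: "('v::finite) set set \<Rightarrow> real^'v \<Rightarrow> real^('v set \<times> 'v)" where
  "incidence_difference E f = (\<chi> i. if i \<in> incidences E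
     then (case i of (e, v) \<Rightarrow> f $ v / sqrt (real (degree E v))
             - (1 / real (card e)) * (\<Sum>u\<in>e. f $ u / sqrt (real (degree E u))))
     else 0)"

definition P_matrix :: "('v::finite) set set \<Rightarrow> real^'v^('v set \<times> 'v)" where
  "P_matrix E = matrix (incidence_difference E)"

definition gradient_matrix ::
  "('v::finite) set set \<Rightarrow> ('v set \<Rightarrow> real) \<Rightarrow> real^'v^('v set \<times> 'v)" where
  "gradient_matrix E \<omega> = diag_on (incidences E) (\<lambda>(e, v). sqrt (\<omega> e)) ** P_matrix E"

lemma linear_incidence_difference: "linear (incidence_difference E)"
  by (rule linearI)
    (auto simp: incidence_difference_def vec_eq_iff algebra_simps add_divide_distrib
      sum.distrib sum_distrib_left sum_divide_distrib split: prod.splits)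

lemma P_matrix_mult: "P_matrix E *v f = incidence_difference E f"
  by (simp add: P_matrix_def linear_incidence_difference matrix_works)

definition leaky_relu :: "real \<Rightarrow> real \<Rightarrow> real" where
  "leaky_relu \<alpha> x = (if x \<ge> 0 then x else \<alpha> * x)"

definition vec_concat :: "real^'d \<Rightarrow> real^'d \<Rightarrow> real^('d + 'd)" where
  "vec_concat x y = (\<chi> i. case i of Inl j \<Rightarrow> x $ j | Inr j \<Rightarrow> y $ j)"

text \<open>
  A multilayer perceptron with hidden layers \<open>0, \<dots>, depth\<close> and an affine scalar output unit.
  Layer \<open>k\<close> has the neurons \<open>0, \<dots>, width k - 1\<close> and the activation function \<open>act k\<close>.
  Only finitely many of the weights and biases are used.
\<close>

record 'm mlp =
  depth :: nat
  width :: "nat \<Rightarrow> nat"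
  act :: "nat \<Rightarrow> real \<Rightarrow> real"
  in_weight :: "nat \<Rightarrow> real^'m"
  weight :: "nat \<Rightarrow> nat \<Rightarrow> nat \<Rightarrow> real"
  bias :: "nat \<Rightarrow> nat \<Rightarrow> real"
  out_weight :: "nat \<Rightarrow> real"
  out_bias :: real

primrec mlp_neuron :: "('m::finite) mlp \<Rightarrow> real^'m \<Rightarrow> nat \<Rightarrow> nat \<Rightarrow> real" where
  "mlp_neuron \<theta> x 0 i = act \<theta> 0 (in_weight \<theta> i \<bullet> x + bias \<theta> 0 i)"
| "mlp_neuron \<theta> x (Suc k) i =
     act \<theta> (Suc k) ((\<Sum>j<width \<theta> k. weight \<theta> (Suc k) i j * mlp_neuron \<theta> x k j) + bias \<theta> (Suc k) i)"

definition mlp_eval :: "('m::finite) mlp \<Rightarrow> real^'m \<Rightarrow> real" where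
  "mlp_eval \<theta> x =
     (\<Sum>j<width \<theta> (depth \<theta>). out_weight \<theta> j * mlp_neuron \<theta> x (depth \<theta>) j) + out_bias \<theta>"

text \<open>\<^const>\<open>local_lipschitz\<close> is meant for time-dependent maps; the time argument is a dummy here.\<close>

definition locally_lipschitz :: "('a::metric_space \<Rightarrow> 'b::metric_space) \<Rightarrow> bool" where
  "locally_lipschitz f \<longleftrightarrow> local_lipschitz (UNIV :: real set) UNIV (\<lambda>_. f)"

text \<open>
  An aggregator is a function of the multiset of the representations of the nodes of a hyperedge
  (repeated rows count, as in mean pooling), which makes it permutation invariant.
\<close>

definition edge_rep ::
  "((real^'d) multiset \<Rightarrow> real^'d) \<Rightarrow> real^'d^('v::finite) \<Rightarrow> 'v set \<Rightarrow> real^'d" where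
  "edge_rep Agg X e = Agg (image_mset (\<lambda>u. X $ u) (mset_set e))"

definition locally_lipschitz_aggregator ::
  "('v::finite) set set \<Rightarrow> ((real^'d) multiset \<Rightarrow> real^'d) \<Rightarrow> bool" where
  "locally_lipschitz_aggregator E Agg \<longleftrightarrow>
     (\<forall>e\<in>E. locally_lipschitz (\<lambda>X :: real^'d^'v. edge_rep Agg X e))"

definition score ::
  "real \<Rightarrow> ((real^'d) multiset \<Rightarrow> real^'d) \<Rightarrow> ('d + 'd) mlp \<Rightarrow> real^'d^('v::finite)
    \<Rightarrow> 'v set \<Rightarrow> 'v \<Rightarrow> real" where
  "score \<alpha> Agg \<theta> X e v = leaky_relu \<alpha> (mlp_eval \<theta> (vec_concat (X $ v) (edge_rep Agg X e)))"

definition modulation ::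
  "('v::finite) set set \<Rightarrow> real \<Rightarrow> real \<Rightarrow> ((real^'d) multiset \<Rightarrow> real^'d) \<Rightarrow> ('d + 'd) mlp
    \<Rightarrow> real^'d^'v \<Rightarrow> 'v set \<Rightarrow> 'v \<Rightarrow> real" where
  "modulation E \<epsilon> \<alpha> Agg \<theta> X e v =
     (1 - \<epsilon>) * (exp (score \<alpha> Agg \<theta> X e v) / (\<Sum>e'\<in>{e'\<in>E. v \<in> e'}. exp (score \<alpha> Agg \<theta> X e' v)))
     + \<epsilon> / real (degree E v)"

definition A_matrix ::
  "('v::finite) set set \<Rightarrow> real \<Rightarrow> real \<Rightarrow> ((real^'d) multiset \<Rightarrow> real^'d) \<Rightarrow> ('d + 'd) mlp
    \<Rightarrow> real^'d^'v \<Rightarrow> real^('v set \<times> 'v)^('v set \<times> 'v)" where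
  "A_matrix E \<epsilon> \<alpha> Agg \<theta> X = diag_on (incidences E) (\<lambda>(e, v). modulation E \<epsilon> \<alpha> Agg \<theta> X e v)"

definition null_vector :: "('v::finite) set set \<Rightarrow> real^'v" where
  "null_vector E = (\<chi> v. sqrt (real (degree E v)))"

definition null_space :: "('v::finite) set set \<Rightarrow> (real^'d^'v) set" where
  "null_space E = {(\<chi> v. null_vector E $ v *\<^sub>R c) | c. True}"

definition orthogonal_projector :: "('a::real_inner) set \<Rightarrow> 'a \<Rightarrow> 'a" where
  "orthogonal_projector S x = (THE y. y \<in> S \<and> (\<forall>w\<in>S. orthogonal (x - y) w))"

definition Q_proj :: "('v::finite) set set \<Rightarrow> real^'d^'v \<Rightarrow> real^'d^'v" where
  "Q_proj E X = X - orthogonal_projector (null_space E) X"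

definition rayleigh ::
  "('v::finite) set set \<Rightarrow> ('v set \<Rightarrow> real) \<Rightarrow> real \<Rightarrow> real \<Rightarrow> ((real^'d) multiset \<Rightarrow> real^'d)
    \<Rightarrow> ('d + 'd) mlp \<Rightarrow> real^'d^'v \<Rightarrow> real" where
  "rayleigh E \<omega> \<epsilon> \<alpha> Agg \<theta> X =
     (let G = gradient_matrix E \<omega>; Z = Q_proj E X in
      if Z = 0 then 0
      else ((G ** Z) \<bullet> (A_matrix E \<epsilon> \<alpha> Agg \<theta> X ** (G ** Z))) / (norm Z)\<^sup>2)"

definition softplus :: "real \<Rightarrow> real" where
  "softplus \<eta> = ln (1 + exp \<eta>)"

definition reaction ::
  "('v::finite) set set \<Rightarrow> ('v set \<Rightarrow> real) \<Rightarrow> real \<Rightarrow> real \<Rightarrow> ((real^'d) multiset \<Rightarrow> real^'d)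
    \<Rightarrow> ('d + 'd) mlp \<Rightarrow> real \<Rightarrow> real^'d^'v \<Rightarrow> real^'d^'v" where
  "reaction E \<omega> \<epsilon> \<alpha> Agg \<theta> \<eta> X =
     (rayleigh E \<omega> \<epsilon> \<alpha> Agg \<theta> X + tanh (softplus \<eta> - (norm (Q_proj E X))\<^sup>2)) *\<^sub>R Q_proj E X"

definition hnrd_field ::
  "('v::finite) set set \<Rightarrow> ('v set \<Rightarrow> real) \<Rightarrow> real \<Rightarrow> real \<Rightarrow> ((real^'d) multiset \<Rightarrow> real^'d)
    \<Rightarrow> ('d + 'd) mlp \<Rightarrow> real \<Rightarrow> real^'d^'v \<Rightarrow> real^'d^'v" where
  "hnrd_field E \<omega> \<epsilon> \<alpha> Agg \<theta> \<eta> X =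
     - (transpose (gradient_matrix E \<omega>) ** A_matrix E \<epsilon> \<alpha> Agg \<theta> X ** gradient_matrix E \<omega> ** X)
     + reaction E \<omega> \<epsilon> \<alpha> Agg \<theta> \<eta> X"

text \<open>Values of solutions and semiflows at negative times are irrelevant throughout.\<close>

definition C1_solution ::
  "('a::real_normed_vector \<Rightarrow> 'a) \<Rightarrow> 'a \<Rightarrow> (real \<Rightarrow> 'a) \<Rightarrow> bool" where
  "C1_solution F x0 x \<longleftrightarrow>
     x 0 = x0 \<and>
     (\<forall>t\<ge>0. (x has_vector_derivative F (x t)) (at t within {0..})) \<and>
     continuous_on {0..} (\<lambda>t. F (x t))"

definition continuous_semiflow :: "(real \<Rightarrow> 'a::topological_space \<Rightarrow> 'a) \<Rightarrow> bool" where
  "continuous_semiflow S \<longleftrightarrow>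
     (\<forall>x. S 0 x = x) \<and>
     (\<forall>s\<ge>0. \<forall>t\<ge>0. \<forall>x. S (s + t) x = S s (S t x)) \<and>
     continuous_on ({0..} \<times> UNIV) (\<lambda>(t, x). S t x)"

definition semiflow_generated_by ::
  "('a::real_normed_vector \<Rightarrow> 'a) \<Rightarrow> (real \<Rightarrow> 'a \<Rightarrow> 'a) \<Rightarrow> bool" where
  "semiflow_generated_by F S \<longleftrightarrow>
     continuous_semiflow S \<and>
     (\<forall>x0. C1_solution F x0 (\<lambda>t. S t x0) \<and>
        (\<forall>x. C1_solution F x0 x \<longrightarrow> (\<forall>t\<ge>0. x t = S t x0)))"

end

theory Submission
  imports Defs
begin

text \<open>
  Since \<open>G\<close> annihilates the null mode, \<open>G X = G (Q X)\<close>, so in \<open>d/dt \<parallel>Q X\<parallel>\<^sup>2\<close> the diffusion term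
  cancels against the Rayleigh quotient in the reaction. Hence \<open>y = \<parallel>Q X\<parallel>\<^sup>2\<close> solves the scalar
  equation \<open>y' = 2 tanh (\<tau> - y) y\<close>. Along it \<open>\<bar>ln y - ln \<tau>\<bar>\<close> does not increase, so \<open>y\<close> stays above
  some \<open>m > 0\<close>; and \<open>u = sinh (\<tau> - y)\<close> satisfies \<open>u' = -2 y u\<close>, so \<open>u\<^sup>2\<close> decays like \<open>exp (-4 m t)\<close>.
\<close>

section \<open>The scalar equation\<close>

text \<open>For positive times the derivative within \<open>{0..}\<close> is an ordinary one, and at
  the endpoint 0 continuity suffices. All estimates for the scalar equation come from this lemma,
  with an integrating factor built into \<open>f\<close> where Gronwall's inequality would otherwise
  be used.\<close>

lemma nonincreasing_of_nonpos_derivative: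
  fixes f f' :: "real \<Rightarrow> real"
  assumes der: "\<And>t. t \<ge> 0 \<Longrightarrow> (f has_real_derivative f' t) (at t within {0..})"
    and nonpos: "\<And>t. t \<ge> 0 \<Longrightarrow> f' t \<le> 0"
    and "t \<ge> 0"
  shows "f t \<le> f 0"
proof (cases "t = 0")
  case False
  with \<open>t \<ge> 0\<close> have "0 < t" by simp
  then show ?thesis
  proof (rule DERIV_nonpos_imp_decreasing_open[OF less_imp_le])
    fix x :: real
    assume x: "0 < x" "x < t"
    then have "at x within {0..} = at x"
      by (intro at_within_interior) auto
    with der[of x] nonpos[of x] x show "\<exists>y. (f has_real_derivative y) (at x) \<and> y \<le> 0"
      by auto
  next
    have "continuous_on {0..} f"
      by (rule DERIV_continuous_on[where D = f']) (use der in auto)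
    then show "continuous_on {0..t} f"
      by (rule continuous_on_subset) auto
  qed
qed simp

lemma tanh_ode_tendsto:
  fixes y :: "real \<Rightarrow> real"
  assumes der: "\<And>t. t \<ge> 0 \<Longrightarrow>
      (y has_real_derivative 2 * tanh (\<tau> - y t) * y t) (at t within {0..})"
    and nonneg: "\<And>t. t \<ge> 0 \<Longrightarrow> y t \<ge> 0"
    and y0: "y 0 > 0" and \<tau>: "\<tau> > 0"
  shows "(y \<longlongrightarrow> \<tau>) at_top"
proof -
  have pos: "y t > 0" if t: "t \<ge> 0" for t
  proof -
    \<comment> \<open>Since tanh > -1, y' >= -2 y, so y exp(2 t) cannot decrease; the sign is
      flipped to fit the monotonicity lemma. Strict positivity is needed before ln (y t) can be
      differentiated.\<close>
    have "- (y t * exp (2 * t)) \<le> - (y 0 * exp (2 * 0))"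
    proof (rule nonincreasing_of_nonpos_derivative[where f = "\<lambda>t. - (y t * exp (2 * t))"])
      fix s :: real assume s: "s \<ge> 0"
      show "((\<lambda>t. - (y t * exp (2 * t))) has_real_derivative
          - (2 * y s * exp (2 * s) * (1 + tanh (\<tau> - y s)))) (at s within {0..})"
        by (rule derivative_eq_intros der[OF s] refl | simp add: algebra_simps)+
      show "- (2 * y s * exp (2 * s) * (1 + tanh (\<tau> - y s))) \<le> 0"
        using nonneg[OF s] tanh_real_gt_neg1[of "\<tau> - y s"] by simp
    qed (rule t)
    with y0 have "y t * exp (2 * t) > 0" by simp
    then show ?thesis by (simp add: zero_less_mult_iff)
  qed
  define k where "k = \<bar>ln (y 0) - ln \<tau>\<bar>"
  \<comment> \<open>The bound |ln y - ln \<tau>| <= k confines y to within a factor exp(k) of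
    \<tau>; \<open>m\<close> is the lower end of that range.\<close>
  define m where "m = \<tau> * exp (- k)"
  have m: "m > 0" using \<tau> by (simp add: m_def)
  have lower: "y t \<ge> m" if t: "t \<ge> 0" for t
  proof -
    \<comment> \<open>The square replaces the absolute value because it is differentiable
      everywhere. In its derivative the factor y cancels against the 1/y from ln.\<close>
    have "(ln (y t) - ln \<tau>)\<^sup>2 \<le> (ln (y 0) - ln \<tau>)\<^sup>2"
    proof (rule nonincreasing_of_nonpos_derivative[where f = "\<lambda>t. (ln (y t) - ln \<tau>)\<^sup>2"])
      fix s :: real assume s: "s \<ge> 0"
      show "((\<lambda>t. (ln (y t) - ln \<tau>)\<^sup>2) has_real_derivative
          4 * ((ln (y s) - ln \<tau>) * tanh (\<tau> - y s))) (at s within {0..})"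
        using pos[OF s] by (auto intro!: derivative_eq_intros der[OF s])
      \<comment> \<open>The two factors have opposite signs, on either side of y = \<tau>.\<close>
      have "(ln (y s) - ln \<tau>) * tanh (\<tau> - y s) \<le> 0"
        using pos[OF s] \<tau> by (cases "y s \<le> \<tau>") (auto simp: mult_le_0_iff)
      then show "4 * ((ln (y s) - ln \<tau>) * tanh (\<tau> - y s)) \<le> 0" by linarith
    qed (rule t)
    then have "\<bar>ln (y t) - ln \<tau>\<bar> \<le> k"
      by (simp add: k_def abs_le_square_iff)
    then have "ln m \<le> ln (y t)"
      using \<tau> by (simp add: m_def ln_mult)
    then show ?thesis using m pos[OF t] by simp
  qed
  \<comment> \<open>As cosh * tanh = sinh, this substitution removes the tanh and leaves an equation
    linear in u, with rate 2 y >= 2 m.\<close>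
  define u where "u t = sinh (\<tau> - y t)" for t
  have bound: "(u t)\<^sup>2 \<le> (u 0)\<^sup>2 * exp (- (4 * m * t))" if t: "t \<ge> 0" for t
  proof -
    \<comment> \<open>The derivative of u^2 is -4 y u^2, so the integrating factor exp(4 m t) leaves
      the coefficient 4 (m - y) <= 0.\<close>
    have "(u t)\<^sup>2 * exp (4 * m * t) \<le> (u 0)\<^sup>2 * exp (4 * m * 0)"
    proof (rule nonincreasing_of_nonpos_derivative[where f = "\<lambda>t. (u t)\<^sup>2 * exp (4 * m * t)"])
      fix s :: real assume s: "s \<ge> 0"
      have "(u has_real_derivative cosh (\<tau> - y s) * - (2 * tanh (\<tau> - y s) * y s))
          (at s within {0..})"
        unfolding u_def by (auto intro!: derivative_eq_intros der[OF s])
      then have du: "(u has_real_derivative - (2 * y s * u s)) (at s within {0..})"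
        by (simp add: u_def tanh_def mult_ac)
      show "((\<lambda>t. (u t)\<^sup>2 * exp (4 * m * t)) has_real_derivative
          4 * (m - y s) * ((u s)\<^sup>2 * exp (4 * m * s))) (at s within {0..})"
        by (rule derivative_eq_intros du refl | simp add: algebra_simps power2_eq_square)+
      show "4 * (m - y s) * ((u s)\<^sup>2 * exp (4 * m * s)) \<le> 0"
        using lower[OF s] by (simp add: mult_le_0_iff)
    qed (rule t)
    then show ?thesis by (simp add: exp_minus field_simps)
  qed
  have lim: "((\<lambda>t. (u 0)\<^sup>2 * exp (- (4 * m * t))) \<longlongrightarrow> (u 0)\<^sup>2 * 0) at_top"
    using m by (intro tendsto_intros filterlim_compose[OF exp_at_bot]
      filterlim_compose[OF filterlim_uminus_at_bot_at_top]
      filterlim_tendsto_pos_mult_at_top[OF tendsto_const] filterlim_ident) simp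
  have upper: "\<forall>\<^sub>F t in at_top. (u t)\<^sup>2 \<le> (u 0)\<^sup>2 * exp (- (4 * m * t))"
    using bound by (rule eventually_at_top_linorderI[of 0])
  have "((\<lambda>t. (u t)\<^sup>2) \<longlongrightarrow> 0) at_top"
    by (rule tendsto_sandwich[OF _ upper tendsto_const lim[unfolded mult_zero_right]]) simp
  then have "(u \<longlongrightarrow> 0) at_top" by simp
  \<comment> \<open>Convergence returns from u to y through the continuous inverse of sinh.\<close>
  then have "((\<lambda>t. \<tau> - arsinh (u t)) \<longlongrightarrow> \<tau> - arsinh 0) at_top"
    by (intro tendsto_intros)
  then show ?thesis by (simp add: u_def arsinh_sinh_real)
qed

section \<open>The orthogonal projection onto the null mode\<close>

text \<open>Two candidates differ by an element of S to which both residuals are orthogonal, so the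
  difference is orthogonal to itself. This settles the definite description in
  \<open>orthogonal_projector\<close>.\<close>

lemma orthogonal_projector_unique:
  fixes S :: "'a::euclidean_space set"
  assumes S: "subspace S" and y: "y \<in> S" "\<And>w. w \<in> S \<Longrightarrow> orthogonal (x - y) w"
  shows "orthogonal_projector S x = y"
  unfolding orthogonal_projector_def
proof (rule the_equality)
  fix z assume z: "z \<in> S \<and> (\<forall>w\<in>S. orthogonal (x - z) w)"
  with S y have "y - z \<in> S" by (simp add: subspace_diff)
  with y z have "(x - z) \<bullet> (y - z) = 0" "(x - y) \<bullet> (y - z) = 0"
    by (auto simp: orthogonal_def)
  then have "(y - z) \<bullet> (y - z) = 0"
    by (simp add: inner_diff_left)
  then show "z = y" by simp
qed (use y in auto)

lemma orthogonal_projector_properties: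
  fixes S :: "'a::euclidean_space set"
  assumes S: "subspace S"
  shows orthogonal_projector_in: "orthogonal_projector S x \<in> S"
    and orthogonal_projector_orthogonal: "w \<in> S \<Longrightarrow> orthogonal (x - orthogonal_projector S x) w"
proof -
  obtain y z where "y \<in> span S" "\<And>w. w \<in> span S \<Longrightarrow> orthogonal z w" "x = y + z"
    using orthogonal_subspace_decomp_exists[of S x] by blast
  moreover have "span S = S" using S by simp
  ultimately have y: "y \<in> S" "\<And>w. w \<in> S \<Longrightarrow> orthogonal (x - y) w" by auto
  then have "orthogonal_projector S x = y"
    by (intro orthogonal_projector_unique[OF S])
  with y show "orthogonal_projector S x \<in> S"
    "w \<in> S \<Longrightarrow> orthogonal (x - orthogonal_projector S x) w" by auto
qed

text \<open>By uniqueness it suffices that the right-hand sides lie in S and leave residuals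
  orthogonal to S.\<close>

lemma linear_orthogonal_projector:
  fixes S :: "'a::euclidean_space set"
  assumes S: "subspace S"
  shows "linear (orthogonal_projector S)"
proof (rule linearI)
  note p = orthogonal_projector_properties[OF S]
  show "orthogonal_projector S (x + y) = orthogonal_projector S x + orthogonal_projector S y" for x y
  proof (rule orthogonal_projector_unique[OF S])
    fix w assume "w \<in> S"
    with p(2)[of w x] p(2)[of w y]
    show "orthogonal (x + y - (orthogonal_projector S x + orthogonal_projector S y)) w"
      by (simp add: orthogonal_def inner_diff_left inner_add_left)
  qed (simp add: p subspace_add[OF S])
  show "orthogonal_projector S (c *\<^sub>R x) = c *\<^sub>R orthogonal_projector S x" for c x
  proof (rule orthogonal_projector_unique[OF S])
    fix w assume "w \<in> S"
    with p(2)[of w x]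
    show "orthogonal (c *\<^sub>R x - c *\<^sub>R orthogonal_projector S x) w"
      by (simp add: orthogonal_def flip: scaleR_diff_right)
  qed (simp add: p subspace_scale[OF S])
qed

text \<open>By Pythagoras, x - a is the residual plus an orthogonal vector of S, so no point a of S
  is nearer than the projection. This turns the distance limit into the limit for
  \<open>Q_proj\<close>.\<close>

lemma infdist_subspace_eq:
  fixes S :: "'a::euclidean_space set"
  assumes S: "subspace S"
  shows "infdist x S = norm (x - orthogonal_projector S x)"
proof (rule antisym)
  let ?p = "orthogonal_projector S x"
  note p = orthogonal_projector_properties[OF S]
  show "infdist x S \<le> norm (x - ?p)"
    using infdist_le[OF p(1), of x x] by (simp add: dist_norm)
  have "norm (x - ?p) \<le> norm (x - a)" if a: "a \<in> S" for a
  proof -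
    have "orthogonal (x - ?p) (?p - a)"
      by (intro p subspace_diff[OF S] a)
    then have "(norm (x - ?p + (?p - a)))\<^sup>2 = (norm (x - ?p))\<^sup>2 + (norm (?p - a))\<^sup>2"
      by (rule norm_add_Pythagorean)
    then have "(norm (x - ?p))\<^sup>2 \<le> (norm (x - a))\<^sup>2" by simp
    then show ?thesis by (rule power2_le_imp_le) simp
  qed
  with S show "norm (x - ?p) \<le> infdist x S"
    using subspace_0[OF S] by (auto simp: infdist_def dist_norm intro!: cINF_greatest)
qed

lemma subspace_null_space: "subspace (null_space E)"
proof (rule subspaceI)
  show "0 \<in> null_space E"
    unfolding null_space_def by (auto simp: vec_eq_iff intro!: exI[of _ 0])
  show "x + y \<in> null_space E" if "x \<in> null_space E" "y \<in> null_space E" for x y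
    using that unfolding null_space_def
    by (auto simp: vec_eq_iff) (metis distrib_left vector_add_component)
  show "c *\<^sub>R x \<in> null_space E" if "x \<in> null_space E" for c x
    using that unfolding null_space_def
    by (auto simp: vec_eq_iff) (metis vector_scaleR_component real_scaleR_def)
qed

lemma linear_Q_proj: "linear (Q_proj E)"
  unfolding Q_proj_def
  by (intro linear_compose_sub linear_ident linear_orthogonal_projector subspace_null_space)

lemma inner_Q_proj: "Q_proj E X \<bullet> Q_proj E Y = Q_proj E X \<bullet> Y"
  using orthogonal_projector_properties[OF subspace_null_space[of E]]
  by (auto simp: Q_proj_def orthogonal_def inner_diff_right)

section \<open>The dissipation identity\<close>

text \<open>Both sides are the same triple sum; only the order of summation changes. It moves the
  transposed gradient across the Frobenius product.\<close>

lemma matrix_mul_adjoint: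
  fixes A :: "real^'n^'m" and X :: "real^'k^'n" and Y :: "real^'k^'m"
  shows "X \<bullet> (transpose A ** Y) = (A ** X) \<bullet> Y"
proof -
  have "X \<bullet> (transpose A ** Y) = (\<Sum>v\<in>UNIV. \<Sum>j\<in>UNIV. \<Sum>i\<in>UNIV. A$i$v * X$v$j * Y$i$j)"
    by (simp add: inner_vec_def matrix_matrix_mult_def transpose_def sum_distrib_left mult_ac)
  also have "\<dots> = (\<Sum>v\<in>UNIV. \<Sum>i\<in>UNIV. \<Sum>j\<in>UNIV. A$i$v * X$v$j * Y$i$j)"
    by (intro sum.cong refl sum.swap)
  also have "\<dots> = (\<Sum>i\<in>UNIV. \<Sum>v\<in>UNIV. \<Sum>j\<in>UNIV. A$i$v * X$v$j * Y$i$j)"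
    by (rule sum.swap)
  also have "\<dots> = (\<Sum>i\<in>UNIV. \<Sum>j\<in>UNIV. \<Sum>v\<in>UNIV. A$i$v * X$v$j * Y$i$j)"
    by (intro sum.cong refl sum.swap)
  also have "\<dots> = (A ** X) \<bullet> Y"
    by (simp add: inner_vec_def matrix_matrix_mult_def sum_distrib_right)
  finally show ?thesis .
qed

text \<open>A node of a hyperedge has positive degree, so dividing by the square root of the degree
  turns the null vector into the constant 1 on that hyperedge, and a constant equals its
  mean.\<close>

lemma incidence_difference_null_vector: "incidence_difference E (null_vector E) = 0"
proof -
  have one: "null_vector E $ u / sqrt (real (degree E u)) = 1" if "e \<in> E" "u \<in> e" for e u
  proof -
    have "degree E u > 0"
      using that unfolding degree_def by (auto simp: card_gt_0_iff)
    then show ?thesis by (simp add: null_vector_def)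
  qed
  have "incidence_difference E (null_vector E) $ (e, v) = 0" for e v
  proof (cases "e \<in> E \<and> v \<in> e")
    case True
    then have "(\<Sum>u\<in>e. null_vector E $ u / sqrt (real (degree E u))) = (\<Sum>u\<in>e. 1)"
      by (intro sum.cong refl one[of e]) auto
    then have sum: "(\<Sum>u\<in>e. null_vector E $ u / sqrt (real (degree E u))) = real (card e)"
      by simp
    have card: "real (card e) \<noteq> 0"
      using True by auto
    have "incidence_difference E (null_vector E) $ (e, v) =
        null_vector E $ v / sqrt (real (degree E v))
        - (1 / real (card e)) * (\<Sum>u\<in>e. null_vector E $ u / sqrt (real (degree E u)))"
      using True by (simp add: incidence_difference_def incidences_def)
    also have "\<dots> = 1 - (1 / real (card e)) * real (card e)"
      by (simp only: sum one[OF conjunct1[OF True] conjunct2[OF True]])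
    also have "\<dots> = 0"
      by (simp only: times_divide_eq_left mult_1 divide_self[OF card] diff_self)
    finally show ?thesis .
  qed (auto simp: incidence_difference_def incidences_def)
  then show ?thesis by (simp add: vec_eq_iff)
qed

text \<open>Every column of such a Y is a scalar multiple of the null vector, which the gradient
  annihilates.\<close>

lemma gradient_matrix_null_space:
  assumes "Y \<in> null_space E"
  shows "gradient_matrix E \<omega> ** Y = 0"
proof -
  obtain c where Y: "Y = (\<chi> v. null_vector E $ v *\<^sub>R c)"
    using assms by (auto simp: null_space_def)
  have "gradient_matrix E \<omega> *v null_vector E = 0"
    unfolding gradient_matrix_def
    by (simp add: P_matrix_mult incidence_difference_null_vector flip: matrix_vector_mul_assoc)
  moreover have "(gradient_matrix E \<omega> ** Y) $ i $ j = (gradient_matrix E \<omega> *v null_vector E) $ i * c $ j"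
    for i j
    by (simp add: Y matrix_matrix_mult_def matrix_vector_mult_def sum_distrib_left mult_ac)
  ultimately show ?thesis by (simp add: vec_eq_iff)
qed

lemma gradient_matrix_Q_proj: "gradient_matrix E \<omega> ** Q_proj E X = gradient_matrix E \<omega> ** X"
proof -
  let ?p = "orthogonal_projector (null_space E) X"
  have "gradient_matrix E \<omega> ** X = gradient_matrix E \<omega> ** (Q_proj E X + ?p)"
    by (simp add: Q_proj_def)
  also have "\<dots> = gradient_matrix E \<omega> ** Q_proj E X"
    by (simp add: matrix_add_ldistrib gradient_matrix_null_space
        orthogonal_projector_in[OF subspace_null_space])
  finally show ?thesis by simp
qed

text \<open>The diffusion term contributes minus the quadratic form of A at G Z, which is the
  numerator of the Rayleigh quotient. The reaction adds that quotient times the squared norm of Z,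
  so only the tanh term survives.\<close>

lemma inner_Q_proj_hnrd_field:
  "Q_proj E X \<bullet> hnrd_field E \<omega> \<epsilon> \<alpha> Agg \<theta> \<eta> X =
     tanh (softplus \<eta> - (norm (Q_proj E X))\<^sup>2) * (norm (Q_proj E X))\<^sup>2"
proof -
  let ?Z = "Q_proj E X" and ?G = "gradient_matrix E \<omega>" and ?A = "A_matrix E \<epsilon> \<alpha> Agg \<theta> X"
  have "?Z \<bullet> (transpose ?G ** ?A ** ?G ** X) = ?Z \<bullet> (transpose ?G ** (?A ** (?G ** ?Z)))"
    by (simp add: gradient_matrix_Q_proj matrix_mul_assoc)
  also have "\<dots> = (?G ** ?Z) \<bullet> (?A ** (?G ** ?Z))"
    by (rule matrix_mul_adjoint)
  \<comment> \<open>For Z = 0 both sides vanish, in agreement with the default value 0 of the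
    quotient.\<close>
  also have "\<dots> = rayleigh E \<omega> \<epsilon> \<alpha> Agg \<theta> X * (norm ?Z)\<^sup>2"
    by (simp add: rayleigh_def Let_def)
  finally show ?thesis
    unfolding hnrd_field_def reaction_def
    by (simp add: algebra_simps flip: power2_norm_eq_inner)
qed

theorem theorem7:
  fixes E :: "('v::finite) set set"
    and \<omega> :: "'v set \<Rightarrow> real"
    and \<epsilon> \<alpha> \<eta> :: real
    and Agg :: "(real^'d) multiset \<Rightarrow> real^('d::finite)"
    and \<theta> :: "('d + 'd) mlp"
    and S :: "real \<Rightarrow> real^'d^'v \<Rightarrow> real^'d^'v"
    and X0 :: "real^'d^'v"
  assumes "weighted_hypergraph E \<omega>"
    and "connected_hypergraph E"
    and "0 < \<epsilon>" and "\<epsilon> < 1"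
    and "0 < \<alpha>" and "\<alpha> < 1"
    and "locally_lipschitz_aggregator E Agg"
    and "locally_lipschitz (mlp_eval \<theta>)"
    and "semiflow_generated_by (hnrd_field E \<omega> \<epsilon> \<alpha> Agg \<theta> \<eta>) S"
    and "Q_proj E X0 \<noteq> 0"
  shows "((\<lambda>t. (norm (Q_proj E (S t X0)))\<^sup>2) \<longlongrightarrow> softplus \<eta>) at_top
    \<and> ((\<lambda>t. (infdist (S t X0) (null_space E))\<^sup>2) \<longlongrightarrow> softplus \<eta>) at_top
    \<and> softplus \<eta> > 0"
proof -
  let ?F = "hnrd_field E \<omega> \<epsilon> \<alpha> Agg \<theta> \<eta>"
  define y where "y t = (norm (Q_proj E (S t X0)))\<^sup>2" for t
  have sol: "S 0 X0 = X0"
    "\<And>t. t \<ge> 0 \<Longrightarrow> ((\<lambda>t. S t X0) has_vector_derivative ?F (S t X0)) (at t within {0..})"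
    using assms(9) by (auto simp: semiflow_generated_by_def C1_solution_def)
  have "(y has_real_derivative 2 * tanh (softplus \<eta> - y t) * y t) (at t within {0..})"
    if t: "t \<ge> 0" for t
  proof -
    let ?Z = "\<lambda>t. Q_proj E (S t X0)"
    \<comment> \<open>In finite dimension the linear projector is bounded, so it commutes with
      differentiation.\<close>
    have Z: "(?Z has_vector_derivative Q_proj E (?F (S t X0))) (at t within {0..})"
      by (rule bounded_linear.has_vector_derivative
          [OF linear_Q_proj[unfolded linear_conv_bounded_linear] sol(2)[OF t]])
    have "((\<lambda>t. ?Z t \<bullet> ?Z t) has_vector_derivative
        ?Z t \<bullet> Q_proj E (?F (S t X0)) + Q_proj E (?F (S t X0)) \<bullet> ?Z t) (at t within {0..})"
      by (rule bounded_bilinear.has_vector_derivative[OF bounded_bilinear_inner Z Z])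
    moreover have "?Z t \<bullet> Q_proj E (?F (S t X0)) = tanh (softplus \<eta> - y t) * y t"
      by (simp add: inner_Q_proj inner_Q_proj_hnrd_field y_def)
    moreover have "(\<lambda>t. ?Z t \<bullet> ?Z t) = y"
      by (simp add: y_def fun_eq_iff power2_norm_eq_inner)
    ultimately show ?thesis
      by (simp add: has_real_derivative_iff_has_vector_derivative inner_commute mult_ac)
  qed
  moreover have "softplus \<eta> > 0"
    by (simp add: softplus_def ln_gt_zero)
  \<comment> \<open>The assumption on \<open>X0\<close> excludes the equilibrium y = 0 of the scalar
    equation.\<close>
  moreover have "y 0 > 0"
    using assms(10) by (simp add: y_def sol(1))
  ultimately have "(y \<longlongrightarrow> softplus \<eta>) at_top"
    by (intro tanh_ode_tendsto) (auto simp: y_def)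
  moreover have "infdist X (null_space E) = norm (Q_proj E X)" for X :: "real^'d^'v"
    by (simp add: infdist_subspace_eq[OF subspace_null_space] Q_proj_def)
  ultimately show ?thesis
    using \<open>softplus \<eta> > 0\<close> by (simp add: y_def[abs_def])
qed

end
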